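(* A numerical semigroup $S$ is almost symmetric if and only if the void poset $(M(S),\preccurlyeq)$ has no nontrivial relations, that is, for all $x,y\in M(S)$, $x\preccurlyeq y$ implies $x=y$.
   Context: A numerical semigroup $S$ is a subset of $\mathbb{N}_0=\{0,1,2,\dots\}$ containing $0$, closed under addition, with finite complement; elements of $\mathbb{N}_0\setminus S$ are its gaps, the genus $g(S)$ is the number of gaps, and the Frobenius number $F(S)$ is the largest gap (defined when $S\ne\mathbb{N}_0$, so here $S\neq\mathbb{N}_0$). The pseudo-Frobenius numbers of $S$ are $PF(S)=\{P\in \mathbb{N}_0\setminus S \mid P+s\in S \text{ for all } s\in S\setminus\{0\}\}$, and the type is $t(S)=|PF(S)|$. $S$ is almost symmetric if $t(S)=2g(S)-F(S)$. The void of $S$ is the set $M(S)$ of gaps $a$ of $S$ such that $F(S)-a$ is also a gap of $S$, partially ordered by $x\preccurlyeq y$ iff $y-x\in S$; this is the void poset. *)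

theory Defs
  imports Main
begin

definition numerical_semigroup :: "nat set \<Rightarrow> bool" where
  "numerical_semigroup S \<longleftrightarrow>
     0 \<in> S \<and> (\<forall>x\<in>S. \<forall>y\<in>S. x + y \<in> S) \<and> finite (UNIV - S)"

definition gaps :: "nat set \<Rightarrow> nat set" where
  "gaps S = UNIV - S"

definition genus :: "nat set \<Rightarrow> nat" where
  "genus S = card (gaps S)"

(* Meaningful only for a numerical semigroup S different from UNIV. *)
definition frobenius :: "nat set \<Rightarrow> nat" where
  "frobenius S = Max (gaps S)"

definition pseudo_frobenius :: "nat set \<Rightarrow> nat set" where
  "pseudo_frobenius S = {P \<in> gaps S. \<forall>s \<in> S - {0}. P + s \<in> S}"

definition semigroup_type :: "nat set \<Rightarrow> nat" where
  "semigroup_type S = card (pseudo_frobenius S)"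

(* Stated over int, so that the subtraction is not truncated. *)
definition almost_symmetric :: "nat set \<Rightarrow> bool" where
  "almost_symmetric S \<longleftrightarrow>
     int (semigroup_type S) = 2 * int (genus S) - int (frobenius S)"

(* Every gap a satisfies a \<le> frobenius S, so the subtraction on nat is exact here. *)
definition void :: "nat set \<Rightarrow> nat set" where
  "void S = {a \<in> gaps S. frobenius S - a \<in> gaps S}"

(* The condition x \<le> y is needed because y - x = 0 \<in> S on nat whenever y < x. *)
definition void_order :: "nat set \<Rightarrow> nat rel" where
  "void_order S = {(x, y) \<in> void S \<times> void S. x \<le> y \<and> y - x \<in> S}"

lemma partial_order_on_void_order:
  assumes "numerical_semigroup S"
  shows "partial_order_on (void S) (void_order S)"
proof -
  have "trans (void_order S)"
  proof (rule transI)
    fix x y z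
    assume xy: "(x, y) \<in> void_order S" and yz: "(y, z) \<in> void_order S"
    then have "y - x \<in> S" and "z - y \<in> S"
      by (auto simp: void_order_def)
    then have "(y - x) + (z - y) \<in> S"
      using assms unfolding numerical_semigroup_def by blast
    moreover have "(y - x) + (z - y) = z - x"
      using xy yz by (auto simp: void_order_def)
    ultimately show "(x, z) \<in> void_order S"
      using xy yz by (auto simp: void_order_def)
  qed
  then show ?thesis
    using assms
    by (auto simp: partial_order_on_def preorder_on_def refl_on_def antisym_def
        void_order_def numerical_semigroup_def)
qed

end

theory Submission
  imports Defs
begin

text \<open>
  Reflection a \<open>\<mapsto>\<close> F - a maps the elements of S up to F bijectively onto the gaps outside the
  void, so M(S) \<open>\<union>\<close> {F} has exactly 2g - F elements. As it contains PF(S), almost symmetry means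
  that PF(S) = M(S) \<open>\<union>\<close> {F}. Finally, an element x of the void fails to be pseudo-Frobenius
  precisely when some x + s with s a nonzero element of S is a gap; such an x + s lies in the void
  again and is strictly above x.
\<close>

lemma finite_gaps: "numerical_semigroup S \<Longrightarrow> finite (gaps S)"
  by (simp add: numerical_semigroup_def gaps_def)

lemma frobenius_in_gaps:
  assumes "numerical_semigroup S" and "S \<noteq> UNIV"
  shows "frobenius S \<in> gaps S"
  unfolding frobenius_def
  by (rule Max_in) (use assms finite_gaps in \<open>auto simp: gaps_def\<close>)

lemma gap_le_frobenius:
  assumes "numerical_semigroup S" and "a \<in> gaps S"
  shows "a \<le> frobenius S"
  unfolding frobenius_def using assms finite_gaps by (simp add: Max_ge)

lemma frobenius_notin_void:
  assumes "numerical_semigroup S"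
  shows "frobenius S \<notin> void S"
  using assms by (auto simp: void_def gaps_def numerical_semigroup_def)

text \<open>If the difference were in \<open>S\<close>, adding \<open>s\<close> back would put the
  Frobenius number in \<open>S\<close>. The bound on \<open>s\<close> keeps the subtraction exact;
  beyond it the truncated difference would be 0, which is no gap.\<close>

lemma frobenius_diff_in_gaps:
  assumes "numerical_semigroup S" and "S \<noteq> UNIV" and "s \<in> S" and "s \<le> frobenius S"
  shows "frobenius S - s \<in> gaps S"
proof (rule ccontr)
  assume "frobenius S - s \<notin> gaps S"
  then have "(frobenius S - s) + s \<in> S"
    using assms(1,3) unfolding numerical_semigroup_def gaps_def by blast
  then show False
    using assms frobenius_in_gaps by (auto simp: gaps_def)
qed

text \<open>The reflection is its own inverse on \<open>{..frobenius S}\<close>, and a gap lies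
  outside the void exactly when its reflection is in \<open>S\<close>.\<close>

lemma bij_betw_reflection:
  assumes "numerical_semigroup S" and "S \<noteq> UNIV"
  shows "bij_betw (\<lambda>a. frobenius S - a) (S \<inter> {..frobenius S}) (gaps S - void S)"
proof (rule bij_betw_byWitness[where f' = "\<lambda>a. frobenius S - a"])
  show "(\<lambda>a. frobenius S - a) ` (S \<inter> {..frobenius S}) \<subseteq> gaps S - void S"
    using frobenius_diff_in_gaps[OF assms] by (auto simp: void_def gaps_def)
qed (use gap_le_frobenius[OF assms(1)] in \<open>auto simp: void_def gaps_def\<close>)

text \<open>With F the Frobenius number and g the genus, \<open>S\<close> has F + 1 - g elements up
  to F. By reflection this is also the number of gaps outside the void, so the void has 2g - F - 1
  elements; inserting F supplies the missing one.\<close>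

lemma card_insert_frobenius_void:
  assumes "numerical_semigroup S" and "S \<noteq> UNIV"
  shows "int (card (insert (frobenius S) (void S))) = 2 * int (genus S) - int (frobenius S)"
proof -
  have fin: "finite (gaps S)" and sub: "void S \<subseteq> gaps S"
    using finite_gaps assms by (auto simp: void_def)
  then have fin': "finite (void S)"
    by (rule rev_finite_subset)
  have "{..frobenius S} = (S \<inter> {..frobenius S}) \<union> gaps S"
    using gap_le_frobenius assms by (auto simp: gaps_def)
  then have "card {..frobenius S} = card (S \<inter> {..frobenius S}) + genus S"
    unfolding genus_def using fin by (subst card_Un_disjoint[symmetric]) (auto simp: gaps_def)
  moreover have "card (S \<inter> {..frobenius S}) = card (gaps S - void S)"
    using bij_betw_same_card[OF bij_betw_reflection[OF assms]] .
  moreover have "card (gaps S - void S) + card (void S) = genus S"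
    unfolding genus_def using card_Diff_subset[OF fin' sub] card_mono[OF fin sub] by simp
  ultimately show ?thesis
    using fin' frobenius_notin_void[OF assms(1)] by simp
qed

lemma frobenius_in_pseudo_frobenius:
  assumes "numerical_semigroup S" and "S \<noteq> UNIV"
  shows "frobenius S \<in> pseudo_frobenius S"
proof -
  \<comment> \<open>The sum exceeds the largest gap because \<open>s\<close> is nonzero.\<close>
  have "frobenius S + s \<in> S" if "s \<in> S - {0}" for s
    using gap_le_frobenius[OF assms(1), of "frobenius S + s"] that by (auto simp: gaps_def)
  then show ?thesis
    using frobenius_in_gaps[OF assms] by (simp add: pseudo_frobenius_def)
qed

text \<open>For any other gap \<open>P\<close>, the reflection is a nonzero element of
  \<open>S\<close>; adding it to \<open>P\<close> gives the Frobenius number, which is a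
  gap.\<close>

lemma pseudo_frobenius_subset:
  assumes "numerical_semigroup S" and "S \<noteq> UNIV"
  shows "pseudo_frobenius S \<subseteq> insert (frobenius S) (void S)"
proof
  fix P assume P: "P \<in> pseudo_frobenius S"
  then have le: "P \<le> frobenius S"
    using gap_le_frobenius assms(1) by (simp add: pseudo_frobenius_def)
  show "P \<in> insert (frobenius S) (void S)"
  proof (rule ccontr)
    assume *: "P \<notin> insert (frobenius S) (void S)"
    then have "frobenius S - P \<in> S - {0}"
      using P le by (auto simp: pseudo_frobenius_def void_def gaps_def)
    then have "P + (frobenius S - P) \<in> S"
      using P unfolding pseudo_frobenius_def by blast
    then show False
      using le frobenius_in_gaps[OF assms] by (simp add: gaps_def)
  qed
qed

text \<open>If the reflection of \<open>x + s\<close> were in \<open>S\<close>, adding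
  \<open>s\<close> would put the reflection of \<open>x\<close> in \<open>S\<close> as well.\<close>

lemma void_add_in_void:
  assumes "numerical_semigroup S" and "x \<in> void S" and "s \<in> S" and "x + s \<in> gaps S"
  shows "x + s \<in> void S"
proof -
  have le: "x + s \<le> frobenius S"
    using gap_le_frobenius assms by blast
  have "frobenius S - (x + s) \<notin> S"
  proof
    assume "frobenius S - (x + s) \<in> S"
    then have "(frobenius S - (x + s)) + s \<in> S"
      using assms(1,3) unfolding numerical_semigroup_def by blast
    moreover have "(frobenius S - (x + s)) + s = frobenius S - x"
      using le by simp
    ultimately show False
      using assms(2) by (simp add: void_def gaps_def)
  qed
  then show ?thesis
    using assms(4) by (simp add: void_def gaps_def)
qed

text \<open>A nontrivial relation from \<open>x\<close> to \<open>y\<close> amounts to a nonzero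
  \<open>s = y - x\<close> in \<open>S\<close> whose sum with \<open>x\<close> stays a gap, which is
  what prevents \<open>x\<close> from being pseudo-Frobenius.\<close>

lemma void_subset_pseudo_frobenius_iff:
  assumes "numerical_semigroup S"
  shows "void S \<subseteq> pseudo_frobenius S \<longleftrightarrow>
    (\<forall>x \<in> void S. \<forall>y \<in> void S. (x, y) \<in> void_order S \<longrightarrow> x = y)"
    (is "?sub \<longleftrightarrow> ?triv")
proof
  assume sub: ?sub
  show ?triv
  proof (intro ballI impI, rule ccontr)
    fix x y
    assume x: "x \<in> void S" and y: "y \<in> void S" and xy: "(x, y) \<in> void_order S" and "x \<noteq> y"
    then have "x \<le> y" and "y - x \<in> S - {0}"
      by (auto simp: void_order_def)
    moreover have "x \<in> pseudo_frobenius S"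
      using sub x by blast
    ultimately have "x + (y - x) \<in> S"
      unfolding pseudo_frobenius_def by blast
    then show False
      using y \<open>x \<le> y\<close> by (simp add: void_def gaps_def)
  qed
next
  assume triv: ?triv
  show ?sub
  proof
    fix x assume x: "x \<in> void S"
    have "x + s \<in> S" if s: "s \<in> S - {0}" for s
    proof (rule ccontr)
      assume "x + s \<notin> S"
      then have "x + s \<in> void S"
        using void_add_in_void[OF assms x] s by (simp add: gaps_def)
      moreover from this have "(x, x + s) \<in> void_order S"
        using x s by (simp add: void_order_def)
      ultimately have "x = x + s"
        using triv x by blast
      then show False
        using s by simp
    qed
    then show "x \<in> pseudo_frobenius S"
      using x by (simp add: pseudo_frobenius_def void_def)
  qed
qed

theorem proposition2p9:
  fixes S :: "nat set"
  assumes "numerical_semigroup S" and "S \<noteq> UNIV"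
  shows "almost_symmetric S \<longleftrightarrow>
    (\<forall>x \<in> void S. \<forall>y \<in> void S. (x, y) \<in> void_order S \<longrightarrow> x = y)"
proof -
  let ?M = "insert (frobenius S) (void S)"
  have "finite ?M"
    using finite_gaps[OF assms(1)] by (simp add: void_def)
  have "almost_symmetric S \<longleftrightarrow> card (pseudo_frobenius S) = card ?M"
    unfolding almost_symmetric_def semigroup_type_def
      card_insert_frobenius_void[OF assms, symmetric] by simp
  \<comment> \<open>A subset of a finite set with the same cardinality is the whole set.\<close>
  also have "\<dots> \<longleftrightarrow> pseudo_frobenius S = ?M"
    using card_subset_eq[OF \<open>finite ?M\<close> pseudo_frobenius_subset[OF assms]] by auto
  \<comment> \<open>The Frobenius number is always pseudo-Frobenius, so only the void remains to be
    tested.\<close>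
  also have "\<dots> \<longleftrightarrow> void S \<subseteq> pseudo_frobenius S"
    using pseudo_frobenius_subset[OF assms] frobenius_in_pseudo_frobenius[OF assms] by blast
  also note void_subset_pseudo_frobenius_iff[OF assms(1)]
  finally show ?thesis .
qed

end
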